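(* Let $\{G_n\}_n$ be a tower of countable groups, and let $L=L^0\supseteq L^1\supseteq\cdots\supseteq L^k\supseteq\cdots\supseteq L^\infty=\bigcap_kL^k$ be the algebraic Gray filtration on $L:=\varprojlim_n^1G_n$. If $L^\infty=L^k$ for some (finite) $k$, then $L^k\cong\{*\}$.
   Context: A tower of groups is $\cdots\to G_n\to G_{n-1}\to\cdots\to G_1\to G_0=*$ (groups not necessarily abelian). $\varprojlim^1_nG_n$ is the pointed set of orbits of $\prod_nG_n$ (as a set) under the action $(g_n)\cdot(x_n)=(g_nx_n\pi(g_{n+1})^{-1})$ of the group $\prod_nG_n$, where $\pi:G_{n+1}\to G_n$ is the structure map. Algebraic Gray filtration: for each $k$, put $G^n_k:=\mathrm{Im}(G_n\to G_k)$ if $n\ge k$ and $G_k^n:=G_n$ if $n<k$. For fixed $k$ the groups $\{G^n_k\}_n$ form a tower, and the natural surjections $G_n\to G_k^n$ induce a surjection of pointed sets $p_k:L=\varprojlim_n^1G_n\to\varprojlim_n^1G_k^n$. Set $L^k:=\mathrm{Ker}\,p_k$ (the preimage of the base point), and $L^\infty:=\bigcap_kL^k$. *)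

theory Defs
  imports "HOL-Algebra.Algebra" "HOL-Library.Countable_Set"
begin

section \<open>Towers of groups\<close>

text \<open>All groups of a tower live in one ambient type. This is no restriction: any sequence of
  groups can be transported into a common (sum) type. The map \<open>p n\<close> goes from \<open>G (n + 1)\<close> to
  \<open>G n\<close>.\<close>

locale group_tower =
  fixes G :: "nat \<Rightarrow> ('a, 'b) monoid_scheme" and p :: "nat \<Rightarrow> 'a \<Rightarrow> 'a"
  assumes group: "group (G n)"
    and map_hom: "p n \<in> hom (G (Suc n)) (G n)"
    and trivial_bottom: "trivial_group (G 0)"

text \<open>\<open>tower_trans p k n\<close> is the composite \<open>G n \<rightarrow> \<dots> \<rightarrow> G k\<close> when \<open>k \<le> n\<close>
  (the identity when \<open>k = n\<close>); its value for \<open>n < k\<close> is irrelevant.\<close>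

primrec tower_trans :: "(nat \<Rightarrow> 'a \<Rightarrow> 'a) \<Rightarrow> nat \<Rightarrow> nat \<Rightarrow> 'a \<Rightarrow> 'a" where
  "tower_trans p k 0 = id"
| "tower_trans p k (Suc n) = (if k \<le> n then tower_trans p k n \<circ> p n else id)"


section \<open>The first derived limit\<close>

text \<open>The action of \<open>\<Prod>n. G n\<close> on its own underlying set. It is made extensional (undefined off
  the carrier) as required by \<^locale>\<open>group_action\<close>.\<close>

definition lim1_action ::
    "(nat \<Rightarrow> ('a, 'b) monoid_scheme) \<Rightarrow> (nat \<Rightarrow> 'a \<Rightarrow> 'a) \<Rightarrow> (nat \<Rightarrow> 'a) \<Rightarrow> (nat \<Rightarrow> 'a) \<Rightarrow> (nat \<Rightarrow> 'a)"
  where "lim1_action G p g =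
    (\<lambda>x\<in>carrier (product_group UNIV G).
       \<lambda>n. g n \<otimes>\<^bsub>G n\<^esub> x n \<otimes>\<^bsub>G n\<^esub> inv\<^bsub>G n\<^esub> (p n (g (Suc n))))"

definition lim1_class ::
    "(nat \<Rightarrow> ('a, 'b) monoid_scheme) \<Rightarrow> (nat \<Rightarrow> 'a \<Rightarrow> 'a) \<Rightarrow> (nat \<Rightarrow> 'a) \<Rightarrow> (nat \<Rightarrow> 'a) set"
  where "lim1_class G p x = orbit (product_group UNIV G) (lim1_action G p) x"

definition lim1 ::
    "(nat \<Rightarrow> ('a, 'b) monoid_scheme) \<Rightarrow> (nat \<Rightarrow> 'a \<Rightarrow> 'a) \<Rightarrow> (nat \<Rightarrow> 'a) set set"
  where "lim1 G p =
    orbits (product_group UNIV G) (carrier (product_group UNIV G)) (lim1_action G p)"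

definition lim1_base ::
    "(nat \<Rightarrow> ('a, 'b) monoid_scheme) \<Rightarrow> (nat \<Rightarrow> 'a \<Rightarrow> 'a) \<Rightarrow> (nat \<Rightarrow> 'a) set"
  where "lim1_base G p = lim1_class G p \<one>\<^bsub>product_group UNIV G\<^esub>"

text \<open>The map induced on \<open>lim1\<close> by a levelwise map \<open>f\<close> into the tower \<open>(H, q)\<close>: the orbit of \<open>x\<close>
  goes to the orbit of \<open>(f n (x n))\<^sub>n\<close>. It is well defined if \<open>f\<close> is a morphism of towers, see
  \<open>lim1_map_class\<close> below.\<close>

definition lim1_map ::
    "(nat \<Rightarrow> ('c, 'd) monoid_scheme) \<Rightarrow> (nat \<Rightarrow> 'c \<Rightarrow> 'c) \<Rightarrow> (nat \<Rightarrow> 'a \<Rightarrow> 'c)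
      \<Rightarrow> (nat \<Rightarrow> 'a) set \<Rightarrow> (nat \<Rightarrow> 'c) set"
  where "lim1_map H q f c = the_elem ((\<lambda>x. lim1_class H q (\<lambda>n. f n (x n))) ` c)"


section \<open>The algebraic Gray filtration\<close>

definition gray_group ::
    "(nat \<Rightarrow> ('a, 'b) monoid_scheme) \<Rightarrow> (nat \<Rightarrow> 'a \<Rightarrow> 'a) \<Rightarrow> nat \<Rightarrow> nat \<Rightarrow> ('a, 'b) monoid_scheme"
  where "gray_group G p k n =
    (if k \<le> n then (G k)\<lparr>carrier := tower_trans p k n ` carrier (G n)\<rparr> else G n)"

text \<open>The structure map \<open>gray_group G p k (n + 1) \<rightarrow> gray_group G p k n\<close>; for \<open>k \<le> n\<close> it is the
  inclusion of one image in \<open>G k\<close> into a larger one.\<close>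

definition gray_map :: "(nat \<Rightarrow> 'a \<Rightarrow> 'a) \<Rightarrow> nat \<Rightarrow> nat \<Rightarrow> 'a \<Rightarrow> 'a"
  where "gray_map p k n = (if k \<le> n then id else p n)"

definition gray_surj :: "(nat \<Rightarrow> 'a \<Rightarrow> 'a) \<Rightarrow> nat \<Rightarrow> nat \<Rightarrow> 'a \<Rightarrow> 'a"
  where "gray_surj p k n = (if k \<le> n then tower_trans p k n else id)"

definition gray_proj ::
    "(nat \<Rightarrow> ('a, 'b) monoid_scheme) \<Rightarrow> (nat \<Rightarrow> 'a \<Rightarrow> 'a) \<Rightarrow> nat
      \<Rightarrow> (nat \<Rightarrow> 'a) set \<Rightarrow> (nat \<Rightarrow> 'a) set"
  where "gray_proj G p k = lim1_map (gray_group G p k) (gray_map p k) (gray_surj p k)"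

definition gray_filtration ::
    "(nat \<Rightarrow> ('a, 'b) monoid_scheme) \<Rightarrow> (nat \<Rightarrow> 'a \<Rightarrow> 'a) \<Rightarrow> nat \<Rightarrow> (nat \<Rightarrow> 'a) set set"
  where "gray_filtration G p k =
    {c \<in> lim1 G p. gray_proj G p k c = lim1_base (gray_group G p k) (gray_map p k)}"

definition gray_filtration_inf ::
    "(nat \<Rightarrow> ('a, 'b) monoid_scheme) \<Rightarrow> (nat \<Rightarrow> 'a \<Rightarrow> 'a) \<Rightarrow> (nat \<Rightarrow> 'a) set set"
  where "gray_filtration_inf G p = (\<Inter>k. gray_filtration G p k)"


section \<open>Well-definedness\<close>

context group_tower
begin

lemma map_closed: "x \<in> carrier (G (Suc n)) \<Longrightarrow> p n x \<in> carrier (G n)"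
  using map_hom[of n] by (auto simp: hom_def)

lemma map_mult:
  "x \<in> carrier (G (Suc n)) \<Longrightarrow> y \<in> carrier (G (Suc n)) \<Longrightarrow>
    p n (x \<otimes>\<^bsub>G (Suc n)\<^esub> y) = p n x \<otimes>\<^bsub>G n\<^esub> p n y"
  using map_hom[of n] by (auto simp: hom_def)

lemma map_one: "p n \<one>\<^bsub>G (Suc n)\<^esub> = \<one>\<^bsub>G n\<^esub>"
  using hom_one[OF map_hom group group] .

lemma carrier_prod: "x \<in> carrier (product_group UNIV G) \<longleftrightarrow> (\<forall>n. x n \<in> carrier (G n))"
  by (auto simp: PiE_UNIV_domain)

lemma group_prod: "Group.group (product_group UNIV G)"
  by (simp add: group)

lemma lim1_action_closed:
  assumes "g \<in> carrier (product_group UNIV G)" "x \<in> carrier (product_group UNIV G)"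
  shows "lim1_action G p g x \<in> carrier (product_group UNIV G)"
proof -
  have "g n \<otimes>\<^bsub>G n\<^esub> x n \<otimes>\<^bsub>G n\<^esub> inv\<^bsub>G n\<^esub> (p n (g (Suc n))) \<in> carrier (G n)" for n
  proof -
    interpret Group.group "G n" by (rule group)
    show ?thesis using assms map_closed by (simp add: carrier_prod del: carrier_product_group)
  qed
  then show ?thesis
    using assms unfolding carrier_prod lim1_action_def by (simp add: carrier_prod del: carrier_product_group)
qed

lemma lim1_action_one:
  assumes "x \<in> carrier (product_group UNIV G)"
  shows "lim1_action G p \<one>\<^bsub>product_group UNIV G\<^esub> x = x"
proof
  fix n
  interpret Group.group "G n" by (rule group)
  show "lim1_action G p \<one>\<^bsub>product_group UNIV G\<^esub> x n = x n"
    using assms unfolding lim1_action_def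
    by (simp add: carrier_prod map_one del: carrier_product_group)
qed

lemma lim1_action_mult:
  assumes g: "g \<in> carrier (product_group UNIV G)" and h: "h \<in> carrier (product_group UNIV G)"
    and x: "x \<in> carrier (product_group UNIV G)"
  shows "lim1_action G p (g \<otimes>\<^bsub>product_group UNIV G\<^esub> h) x = lim1_action G p g (lim1_action G p h x)"
proof
  fix n
  interpret Group.group "G n" by (rule group)
  have c: "g n \<in> carrier (G n)" "h n \<in> carrier (G n)" "x n \<in> carrier (G n)"
    "p n (g (Suc n)) \<in> carrier (G n)" "p n (h (Suc n)) \<in> carrier (G n)"
    "g (Suc n) \<in> carrier (G (Suc n))" "h (Suc n) \<in> carrier (G (Suc n))"
    using assms map_closed unfolding carrier_prod by auto
  have "lim1_action G p (g \<otimes>\<^bsub>product_group UNIV G\<^esub> h) x n =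
      (g n \<otimes>\<^bsub>G n\<^esub> h n) \<otimes>\<^bsub>G n\<^esub> x n \<otimes>\<^bsub>G n\<^esub> inv\<^bsub>G n\<^esub> (p n (g (Suc n)) \<otimes>\<^bsub>G n\<^esub> p n (h (Suc n)))"
    using x c unfolding lim1_action_def by (simp add: map_mult del: carrier_product_group)
  also have "\<dots> = g n \<otimes>\<^bsub>G n\<^esub> (h n \<otimes>\<^bsub>G n\<^esub> x n \<otimes>\<^bsub>G n\<^esub> inv\<^bsub>G n\<^esub> (p n (h (Suc n)))) \<otimes>\<^bsub>G n\<^esub> inv\<^bsub>G n\<^esub> (p n (g (Suc n)))"
    using c by (simp add: inv_mult_group m_assoc)
  also have "\<dots> = lim1_action G p g (lim1_action G p h x) n"
    using x lim1_action_closed[OF h x] unfolding lim1_action_def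
    by (simp del: carrier_product_group)
  finally show "lim1_action G p (g \<otimes>\<^bsub>product_group UNIV G\<^esub> h) x n
      = lim1_action G p g (lim1_action G p h x) n" .
qed

lemma lim1_group_action:
  "group_action (product_group UNIV G) (carrier (product_group UNIV G)) (lim1_action G p)"
proof -
  let ?P = "product_group UNIV G"
  interpret P: Group.group ?P by (rule group_prod)
  have bij: "lim1_action G p g \<in> Bij (carrier ?P)" if g: "g \<in> carrier ?P" for g
  proof -
    have i: "inv\<^bsub>?P\<^esub> g \<in> carrier ?P" using g by (rule P.inv_closed)
    have "bij_betw (lim1_action G p g) (carrier ?P) (carrier ?P)"
    proof (rule bij_betw_byWitness[where f' = "lim1_action G p (inv\<^bsub>?P\<^esub> g)"])
      show "\<forall>x\<in>carrier ?P. lim1_action G p (inv\<^bsub>?P\<^esub> g) (lim1_action G p g x) = x"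
        by (metis P.l_inv g i lim1_action_mult lim1_action_one)
      show "\<forall>x\<in>carrier ?P. lim1_action G p g (lim1_action G p (inv\<^bsub>?P\<^esub> g) x) = x"
        by (metis P.r_inv g i lim1_action_mult lim1_action_one)
    qed (use g i lim1_action_closed in blast)+
    moreover have "lim1_action G p g \<in> extensional (carrier ?P)"
      by (simp add: lim1_action_def)
    ultimately show ?thesis by (simp add: Bij_def)
  qed
  have "lim1_action G p \<in> hom ?P (BijGroup (carrier ?P))"
  proof (rule homI)
    fix g assume "g \<in> carrier ?P"
    then show "lim1_action G p g \<in> carrier (BijGroup (carrier ?P))"
      using bij by (simp add: BijGroup_def)
  next
    fix g h assume g: "g \<in> carrier ?P" and h: "h \<in> carrier ?P"
    have "lim1_action G p (g \<otimes>\<^bsub>?P\<^esub> h) = compose (carrier ?P) (lim1_action G p g) (lim1_action G p h)"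
    proof
      fix x
      show "lim1_action G p (g \<otimes>\<^bsub>?P\<^esub> h) x = compose (carrier ?P) (lim1_action G p g) (lim1_action G p h) x"
        by (cases "x \<in> carrier ?P")
          (use lim1_action_mult[OF g h] in \<open>simp_all add: compose_def lim1_action_def del: carrier_product_group mult_product_group\<close>)
    qed
    then show "lim1_action G p (g \<otimes>\<^bsub>?P\<^esub> h)
        = lim1_action G p g \<otimes>\<^bsub>BijGroup (carrier ?P)\<^esub> lim1_action G p h"
      using bij[OF g] bij[OF h] by (simp add: BijGroup_def del: carrier_product_group mult_product_group)
  qed
  then show ?thesis
    unfolding group_action_def group_hom_def group_hom_axioms_def
    using group_prod group_BijGroup by blast
qed

lemma lim1_class_self:
  assumes "x \<in> carrier (product_group UNIV G)"
  shows "x \<in> lim1_class G p x"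
proof -
  interpret P: Group.group "product_group UNIV G" by (rule group_prod)
  show ?thesis unfolding lim1_class_def orbit_def
    using lim1_action_one[OF assms] P.one_closed by (metis (mono_tags, lifting) mem_Collect_eq)
qed

lemma lim1_class_eq:
  assumes x: "x \<in> carrier (product_group UNIV G)" and y: "y \<in> lim1_class G p x"
  shows "y \<in> carrier (product_group UNIV G)" "lim1_class G p y = lim1_class G p x"
proof -
  let ?P = "product_group UNIV G"
  interpret P: Group.group ?P by (rule group_prod)
  obtain g where g: "g \<in> carrier ?P" and yg: "y = lim1_action G p g x"
    using y unfolding lim1_class_def orbit_def by blast
  show yc: "y \<in> carrier ?P" unfolding yg by (rule lim1_action_closed[OF g x])
  have i: "inv\<^bsub>?P\<^esub> g \<in> carrier ?P" using g by (rule P.inv_closed)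
  have xy: "x = lim1_action G p (inv\<^bsub>?P\<^esub> g) y"
    unfolding yg by (metis P.l_inv g i lim1_action_mult lim1_action_one x)
  have sub: "lim1_class G p (lim1_action G p h z) \<subseteq> lim1_class G p z"
    if "h \<in> carrier ?P" "z \<in> carrier ?P" for h z
  proof
    fix w assume "w \<in> lim1_class G p (lim1_action G p h z)"
    then obtain a where a: "a \<in> carrier ?P" "w = lim1_action G p a (lim1_action G p h z)"
      unfolding lim1_class_def orbit_def by blast
    then have "w = lim1_action G p (a \<otimes>\<^bsub>?P\<^esub> h) z" using that lim1_action_mult by simp
    then show "w \<in> lim1_class G p z"
      unfolding lim1_class_def orbit_def using P.m_closed[OF a(1) that(1)] by blast
  qed
  show "lim1_class G p y = lim1_class G p x"
  proof
    show "lim1_class G p y \<subseteq> lim1_class G p x" unfolding yg by (rule sub[OF g x])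
    show "lim1_class G p x \<subseteq> lim1_class G p y" by (subst xy) (rule sub[OF i yc])
  qed
qed

end

text \<open>Levelwise maps that form a morphism of towers induce a well-defined map on \<open>lim1\<close>.\<close>

lemma lim1_map_class:
  assumes G: "group_tower G p" and H: "group_tower H q"
    and f: "\<And>n. f n \<in> hom (G n) (H n)"
    and comm: "\<And>n x. x \<in> carrier (G (Suc n)) \<Longrightarrow> f n (p n x) = q n (f (Suc n) x)"
    and x: "x \<in> carrier (product_group UNIV G)"
  shows "lim1_map H q f (lim1_class G p x) = lim1_class H q (\<lambda>n. f n (x n))"
proof -
  interpret G: group_tower G p by (rule G)
  interpret H: group_tower H q by (rule H)
  have cl: "(\<lambda>n. f n (z n)) \<in> carrier (product_group UNIV H)"
    if "z \<in> carrier (product_group UNIV G)" for z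
    using that f unfolding G.carrier_prod H.carrier_prod hom_def by blast
  have "lim1_class H q (\<lambda>n. f n (y n)) = lim1_class H q (\<lambda>n. f n (x n))"
    if "y \<in> lim1_class G p x" for y
  proof -
    obtain g where g: "g \<in> carrier (product_group UNIV G)" and y: "y = lim1_action G p g x"
      using \<open>y \<in> lim1_class G p x\<close> unfolding lim1_class_def orbit_def by blast
    have "(\<lambda>n. f n (y n)) = lim1_action H q (\<lambda>n. f n (g n)) (\<lambda>n. f n (x n))"
    proof
      fix n
      interpret A: Group.group "G n" by (rule G.group)
      interpret h: group_hom "G n" "H n" "f n"
        using f[of n] G.group H.group by (simp add: group_hom_def group_hom_axioms_def)
      have c: "g n \<in> carrier (G n)" "x n \<in> carrier (G n)" "g (Suc n) \<in> carrier (G (Suc n))"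
        using g x unfolding G.carrier_prod by auto
      show "f n (y n) = lim1_action H q (\<lambda>n. f n (g n)) (\<lambda>n. f n (x n)) n"
        unfolding y lim1_action_def using x cl[OF x] c G.map_closed[OF c(3)]
        by (simp add: comm[symmetric] del: carrier_product_group)
    qed
    then have "(\<lambda>n. f n (y n)) \<in> lim1_class H q (\<lambda>n. f n (x n))"
      unfolding lim1_class_def orbit_def using cl[OF g] by blast
    then show ?thesis using H.lim1_class_eq(2)[OF cl[OF x]] by blast
  qed
  moreover have "x \<in> lim1_class G p x" by (rule G.lim1_class_self[OF x])
  ultimately have "(\<lambda>y. lim1_class H q (\<lambda>n. f n (y n))) ` lim1_class G p x
      = {lim1_class H q (\<lambda>n. f n (x n))}" by blast
  then show ?thesis unfolding lim1_map_def by simp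
qed

context group_tower
begin

lemma tower_trans_hom: "k \<le> n \<Longrightarrow> tower_trans p k n \<in> hom (G n) (G k)"
proof (induction n)
  case 0
  then show ?case by (simp add: hom_def)
next
  case (Suc n)
  show ?case
  proof (cases "k \<le> n")
    case True
    then show ?thesis using hom_compose[OF map_hom Suc.IH[OF True]] by (simp add: comp_def)
  next
    case False
    then have "k = Suc n" using Suc.prems by simp
    then show ?thesis by (simp add: hom_def)
  qed
qed

lemma gray_surj_hom: "gray_surj p k n \<in> hom (G n) (gray_group G p k n)"
  using tower_trans_hom[of k n] by (auto simp: gray_surj_def gray_group_def hom_def)

lemma gray_surj_onto: "gray_surj p k n ` carrier (G n) = carrier (gray_group G p k n)"
  by (simp add: gray_surj_def gray_group_def)

lemma gray_surj_commutes: "gray_surj p k n (p n x) = gray_map p k n (gray_surj p k (Suc n) x)"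
proof (cases "k \<le> n")
  case False
  then show ?thesis by (cases "k = Suc n") (auto simp: gray_surj_def gray_map_def)
qed (simp add: gray_surj_def gray_map_def)

lemma group_gray: "Group.group (gray_group G p k n)"
proof (cases "k \<le> n")
  case True
  interpret h: group_hom "G n" "G k" "tower_trans p k n"
    using tower_trans_hom[OF True] group by (simp add: group_hom_def group_hom_axioms_def)
  have "subgroup (tower_trans p k n ` carrier (G n)) (G k)" by (rule h.img_is_subgroup)
  then show ?thesis using True group.subgroup_imp_group[OF group] by (simp add: gray_group_def)
qed (simp add: gray_group_def group)

lemma gray_tower: "group_tower (gray_group G p k) (gray_map p k)"
proof (rule group_tower.intro)
  fix n
  show "Group.group (gray_group G p k n)" by (rule group_gray)
  show "gray_map p k n \<in> hom (gray_group G p k (Suc n)) (gray_group G p k n)"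
  proof (rule homI)
    fix x assume "x \<in> carrier (gray_group G p k (Suc n))"
    then obtain u where u: "u \<in> carrier (G (Suc n))" "x = gray_surj p k (Suc n) u"
      using gray_surj_onto by blast
    then have "gray_map p k n x = gray_surj p k n (p n u)" using gray_surj_commutes by simp
    then show "gray_map p k n x \<in> carrier (gray_group G p k n)"
      using map_closed[OF u(1)] gray_surj_onto by blast
  next
    fix x y assume "x \<in> carrier (gray_group G p k (Suc n))" "y \<in> carrier (gray_group G p k (Suc n))"
    then obtain u v where u: "u \<in> carrier (G (Suc n))" "x = gray_surj p k (Suc n) u"
      and v: "v \<in> carrier (G (Suc n))" "y = gray_surj p k (Suc n) v"
      using gray_surj_onto by blast
    have m: "gray_surj p k i (a \<otimes>\<^bsub>G i\<^esub> b) = gray_surj p k i a \<otimes>\<^bsub>gray_group G p k i\<^esub> gray_surj p k i b"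
      if "a \<in> carrier (G i)" "b \<in> carrier (G i)" for i a b
      using that gray_surj_hom[of k i] by (auto simp: hom_def)
    show "gray_map p k n (x \<otimes>\<^bsub>gray_group G p k (Suc n)\<^esub> y)
        = gray_map p k n x \<otimes>\<^bsub>gray_group G p k n\<^esub> gray_map p k n y"
      using u v by (simp add: m[symmetric] gray_surj_commutes[symmetric] map_mult map_closed)
  qed
next
  have "carrier (gray_group G p k 0) = {\<one>\<^bsub>gray_group G p k 0\<^esub>}"
    using trivial_bottom by (auto simp: gray_group_def trivial_group_def)
  then show "trivial_group (gray_group G p k 0)" using group_gray by (simp add: trivial_group_def)
qed

lemma gray_proj_class:
  assumes "x \<in> carrier (product_group UNIV G)"
  shows "gray_proj G p k (lim1_class G p x)
    = lim1_class (gray_group G p k) (gray_map p k) (\<lambda>n. gray_surj p k n (x n))"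
  unfolding gray_proj_def
  using lim1_map_class[of G p "gray_group G p k" "gray_map p k" "gray_surj p k" x]
    group_tower_axioms gray_tower gray_surj_hom gray_surj_commutes assms by blast

lemma gray_filtration_0: "gray_filtration G p 0 = lim1 G p"
proof -
  interpret H: group_tower "gray_group G p 0" "gray_map p 0" by (rule gray_tower)
  let ?H = "gray_group G p 0"
  have car: "carrier (?H n) = {\<one>\<^bsub>?H n\<^esub>}" for n
  proof -
    have "carrier (?H n) \<subseteq> carrier (G 0)"
      using tower_trans_hom[of 0 n] by (auto simp: gray_group_def hom_def)
    moreover have "\<one>\<^bsub>?H n\<^esub> \<in> carrier (?H n)" using H.group[of n] by (simp add: group.is_monoid)
    ultimately show ?thesis using trivial_bottom unfolding trivial_group_def
      by (metis empty_iff singletonD subset_singletonD)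
  qed
  have "gray_proj G p 0 c = lim1_base ?H (gray_map p 0)" if c: "c \<in> lim1 G p" for c
  proof -
    obtain x where x: "x \<in> carrier (product_group UNIV G)" "c = lim1_class G p x"
      using c unfolding lim1_def lim1_class_def orbits_def by blast
    have "gray_surj p 0 n (x n) = \<one>\<^bsub>?H n\<^esub>" for n
    proof -
      have "x n \<in> carrier (G n)" using x(1) carrier_prod by blast
      then show ?thesis using gray_surj_onto[of 0 n] car[of n] by blast
    qed
    then show ?thesis unfolding x(2) gray_proj_class[OF x(1)] lim1_base_def by (simp add: restrict_UNIV)
  qed
  then show ?thesis unfolding gray_filtration_def by blast
qed

lemma tower_trans_Suc: "Suc k \<le> n \<Longrightarrow> tower_trans p k n = p k \<circ> tower_trans p (Suc k) n"
proof (induction n)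
  case (Suc n)
  show ?case
  proof (cases "Suc k \<le> n")
    case True
    then show ?thesis using Suc.IH by (simp add: comp_assoc)
  next
    case False
    then have "n = k" using Suc.prems by simp
    then show ?thesis by (cases k) simp_all
  qed
qed simp

lemma gray_filtration_Suc: "gray_filtration G p (Suc k) \<subseteq> gray_filtration G p k"
proof
  fix c assume c: "c \<in> gray_filtration G p (Suc k)"
  let ?H = "gray_group G p (Suc k)" and ?q = "gray_map p (Suc k)"
  let ?K = "gray_group G p k" and ?r = "gray_map p k"
  define h where "h n = (if Suc k \<le> n then p k else id)" for n
  interpret H: group_tower ?H ?q by (rule gray_tower)
  interpret K: group_tower ?K ?r by (rule gray_tower)
  have hs: "h n (gray_surj p (Suc k) n x) = gray_surj p k n x" for n x
  proof (cases "Suc k \<le> n")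
    case True
    then show ?thesis by (simp add: h_def gray_surj_def tower_trans_Suc)
  next
    case False
    then show ?thesis by (cases "n = k"; cases n) (auto simp: h_def gray_surj_def)
  qed
  have m: "gray_surj p j i (a \<otimes>\<^bsub>G i\<^esub> b) = gray_surj p j i a \<otimes>\<^bsub>gray_group G p j i\<^esub> gray_surj p j i b"
    if "a \<in> carrier (G i)" "b \<in> carrier (G i)" for i j a b
    using that gray_surj_hom[of j i] by (auto simp: hom_def)
  have hom: "h n \<in> hom (?H n) (?K n)" for n
  proof (rule homI)
    fix x assume "x \<in> carrier (?H n)"
    then obtain u where "u \<in> carrier (G n)" "x = gray_surj p (Suc k) n u"
      using gray_surj_onto by blast
    then show "h n x \<in> carrier (?K n)" using hs gray_surj_onto by blast
  next
    fix x y assume "x \<in> carrier (?H n)" "y \<in> carrier (?H n)"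
    then obtain u v where "u \<in> carrier (G n)" "x = gray_surj p (Suc k) n u"
      "v \<in> carrier (G n)" "y = gray_surj p (Suc k) n v"
      using gray_surj_onto by blast
    then show "h n (x \<otimes>\<^bsub>?H n\<^esub> y) = h n x \<otimes>\<^bsub>?K n\<^esub> h n y"
      by (simp add: m[symmetric] hs)
  qed
  have comm: "h n (?q n x) = ?r n (h (Suc n) x)" if x: "x \<in> carrier (?H (Suc n))" for n x
  proof -
    obtain u where "x = gray_surj p (Suc k) (Suc n) u"
      using x gray_surj_onto by blast
    then show ?thesis by (simp add: hs gray_surj_commutes[symmetric])
  qed
  obtain x where x: "x \<in> carrier (product_group UNIV G)" "c = lim1_class G p x"
    using c unfolding gray_filtration_def lim1_def lim1_class_def orbits_def by blast
  let ?y = "\<lambda>n. gray_surj p (Suc k) n (x n)"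
  have y: "?y \<in> carrier (product_group UNIV ?H)"
    unfolding H.carrier_prod using x(1)[unfolded carrier_prod] gray_surj_onto by blast
  have one: "\<one>\<^bsub>product_group UNIV ?H\<^esub> \<in> carrier (product_group UNIV ?H)"
    by (rule monoid.one_closed[OF group.is_monoid[OF H.group_prod]])
  have hmap: "lim1_map ?K ?r h (lim1_class ?H ?q z) = lim1_class ?K ?r (\<lambda>n. h n (z n))"
    if z: "z \<in> carrier (product_group UNIV ?H)" for z
  proof (rule lim1_map_class[of ?H ?q ?K ?r h z])
    show "group_tower ?H ?q" by (rule gray_tower)
  next
    show "group_tower ?K ?r" by (rule gray_tower)
  next
    fix n
    show "h n \<in> hom (?H n) (?K n)" by (rule hom)
  next
    fix n x assume "x \<in> carrier (?H (Suc n))"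
    then show "h n (?q n x) = ?r n (h (Suc n) x)" by (rule comm)
  next
    show "z \<in> carrier (product_group UNIV ?H)" by (rule z)
  qed
  have "lim1_class ?H ?q ?y = lim1_class ?H ?q \<one>\<^bsub>product_group UNIV ?H\<^esub>"
  proof -
    have "gray_proj G p (Suc k) c = lim1_base ?H ?q"
      using c unfolding gray_filtration_def by (rule CollectE) (erule conjunct2)
    then show ?thesis by (simp only: x(2) gray_proj_class[OF x(1)] lim1_base_def)
  qed
  then have "lim1_class ?K ?r (\<lambda>n. h n (?y n))
      = lim1_class ?K ?r (\<lambda>n. h n (\<one>\<^bsub>product_group UNIV ?H\<^esub> n))"
    by (metis hmap[OF y] hmap[OF one])
  moreover have "(\<lambda>n. h n (\<one>\<^bsub>product_group UNIV ?H\<^esub> n)) = \<one>\<^bsub>product_group UNIV ?K\<^esub>"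
  proof -
    have "h n \<one>\<^bsub>?H n\<^esub> = \<one>\<^bsub>?K n\<^esub>" for n
      by (rule hom_one[of "h n" "?H n" "?K n"]) (rule hom H.group K.group)+
    then show ?thesis by (simp add: restrict_UNIV)
  qed
  ultimately have "gray_proj G p k c = lim1_base ?K ?r"
    by (simp only: x(2) gray_proj_class[OF x(1)] lim1_base_def hs)
  then show "c \<in> gray_filtration G p k" using c unfolding gray_filtration_def by blast
qed

end

end

theory Submission
  imports Defs
begin

text \<open>Let \<open>K n\<close> be the kernel of \<open>G n \<rightarrow> gray_group G p k n\<close>; the classes in \<open>gray_filtration G p k\<close>
  are those of sequences in \<open>\<Prod>n. K n\<close>. Fix \<open>m \<ge> k\<close> and let \<open>B\<close> and \<open>A = B \<inter> K m\<close> be the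
  decreasing sequences of images of \<open>G n\<close> and \<open>K n\<close> in \<open>G m\<close>. If all these classes die in
  \<open>lim\<^sup>1\<close> of \<open>B\<close>, then the partial products of any sequence in \<open>\<Prod>j. A j\<close> lie in
  \<open>b B j\<close> for a single \<open>b\<close>. As there are only countably many \<open>b\<close>, a diagonal argument
  shows that \<open>A\<close> is eventually constant. So the tower \<open>K\<close> satisfies the Mittag-Leffler condition,
  hence has trivial \<open>lim\<^sup>1\<close>.\<close>

section \<open>A diagonal argument for decreasing sequences of subgroups\<close>

text \<open>If the intersections dropped infinitely often, each \<open>b\<close> in the countable
  \<open>B 0\<close> could be assigned its own dropping stage \<open>j\<close>. A sequence can then
  be built whose partial product after stage \<open>j\<close> lies outside
  \<open>b B (Suc j)\<close>, so no element of \<open>B 0\<close> can be the \<open>b 0\<close> that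
  \<open>triv\<close> provides.\<close>

lemma (in group) decreasing_subgroups_stabilize:
  fixes B :: "nat \<Rightarrow> 'a set"
  assumes B: "\<And>j. subgroup (B j) G" and dec: "\<And>j. B (Suc j) \<subseteq> B j"
    and count: "countable (B 0)" and N: "subgroup N G"
    and triv: "\<And>x. (\<And>j. x j \<in> B j \<inter> N) \<Longrightarrow> \<exists>b. \<forall>j. b j \<in> B j \<and> x j \<otimes> b (Suc j) = b j"
  shows "\<exists>J. \<forall>j\<ge>J. B j \<inter> N = B J \<inter> N"
proof -
  define S where "S = {j. B (Suc j) \<inter> N \<noteq> B j \<inter> N}"
  have "finite S"
  proof (rule ccontr)
    assume inf: "infinite S"
    have ne: "B 0 \<noteq> {}" using subgroup.one_closed[OF B[of 0]] by blast
    \<comment> \<open>As \<open>S\<close> is infinite, \<open>to_nat_on S\<close> maps it onto all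
      naturals, so \<open>f\<close> already runs through \<open>B 0\<close> on the stages in
      \<open>S\<close>.\<close>
    define f where "f j = from_nat_into (B 0) (to_nat_on S j)" for j
    have f_onto: "\<exists>j\<in>S. f j = b" if "b \<in> B 0" for b
    proof -
      obtain i where "from_nat_into (B 0) i = b"
        using from_nat_into_surj[OF count \<open>b \<in> B 0\<close>] by blast
      moreover obtain j where "j \<in> S" "to_nat_on S j = i"
        using to_nat_on_surj[OF countableI_type inf] by blast
      ultimately show ?thesis unfolding f_def by blast
    qed
    have f_closed: "f j \<in> carrier G" for j
      using from_nat_into[OF ne] subgroup.subset[OF B[of 0]] unfolding f_def by blast
    have "\<exists>a. a \<in> B j \<inter> N \<and> a \<notin> B (Suc j)" if "j \<in> S" for j
      using that dec[of j] unfolding S_def by blast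
    then obtain a where a: "\<And>j. j \<in> S \<Longrightarrow> a j \<in> B j \<inter> N \<and> a j \<notin> B (Suc j)" by metis
    \<comment> \<open>The factor depends on the product \<open>P\<close> so far: if \<open>P\<close>
      lies in the coset \<open>f j B (Suc j)\<close>, then \<open>a j\<close> pushes it out;
      otherwise it is left outside.\<close>
    define step where "step j P = (if j \<in> S \<and> inv (f j) \<otimes> P \<in> B (Suc j) then a j else \<one>)" for j P
    define P where "P = rec_nat \<one> (\<lambda>j Q. Q \<otimes> step j Q)"
    have P_Suc: "P (Suc j) = P j \<otimes> step j (P j)" and P_0: "P 0 = \<one>" for j
      by (simp_all add: P_def)
    have step: "step j Q \<in> B j \<inter> N" for j Q
      using a subgroup.one_closed[OF B] subgroup.one_closed[OF N] unfolding step_def by auto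
    then have step_closed: "step j Q \<in> carrier G" for j Q
      using subgroup.subset[OF N] by blast
    have P_closed: "P j \<in> carrier G" for j
      by (induction j) (simp_all add: P_0 P_Suc step_closed)
    obtain b where b: "\<And>j. b j \<in> B j" and bP: "\<And>j. step j (P j) \<otimes> b (Suc j) = b j"
      using triv[of "\<lambda>j. step j (P j)"] step by blast
    have b_closed: "b j \<in> carrier G" for j
      using b subgroup.subset[OF B] by blast
    \<comment> \<open>The equations of \<open>triv\<close> telescope, so every \<open>P j\<close>
      lies in the coset of \<open>B j\<close> given by the same element \<open>b 0\<close>.\<close>
    have b0: "P j \<otimes> b j = b 0" for j
    proof (induction j)
      case (Suc j)
      then show ?case
        by (metis P_Suc bP m_assoc P_closed step_closed b_closed)
    qed (simp add: P_0 b_closed)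
    obtain j where j: "j \<in> S" "f j = b 0" using f_onto[OF b] by blast
    have "inv (b 0) \<otimes> P i = inv (b i)" for i
    proof -
      have "b 0 \<otimes> inv (b i) = P i"
        using b0[of i] P_closed b_closed by (metis inv_solve_right')
      then show ?thesis
        using b_closed P_closed by (metis inv_closed inv_solve_left)
    qed
    then have mem: "inv (b 0) \<otimes> P (Suc j) \<in> B (Suc j)"
      using subgroup.m_inv_closed[OF B b] by simp
    show False
    \<comment> \<open>At the stage \<open>j\<close> assigned to \<open>b 0\<close>, both branches of
      \<open>step\<close> put \<open>P (Suc j)\<close> outside \<open>b 0 B (Suc j)\<close>, against
      \<open>mem\<close>.\<close>
    proof (cases "inv (b 0) \<otimes> P j \<in> B (Suc j)")
      case True
      have "(inv (b 0) \<otimes> P j) \<otimes> a j \<in> B (Suc j)"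
        using mem True j b_closed P_closed step_closed[of j "P j"]
        by (simp add: P_Suc step_def m_assoc)
      moreover have "a j \<in> carrier G" using a[OF j(1)] subgroup.subset[OF N] by blast
      ultimately have "a j \<in> B (Suc j)"
        using subgroup.m_closed[OF B subgroup.m_inv_closed[OF B True]] b_closed P_closed
        by (metis m_closed inv_closed inv_solve_left)
      then show False using a[OF j(1)] by blast
    next
      case False
      then show False using mem j P_closed by (simp add: P_Suc step_def)
    qed
  qed
  then obtain J where J: "\<And>j. j \<in> S \<Longrightarrow> j < J" using finite_nat_bounded by blast
  have "B j \<inter> N = B J \<inter> N" if "j \<ge> J" for j
    using that
  proof (induction j rule: dec_induct)
    case (step j)
    then have "j \<notin> S" using J by fastforce
    then show ?case using step by (simp add: S_def)
  qed simp
  then show ?thesis by blast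
qed

section \<open>The Mittag-Leffler condition\<close>

context group_tower
begin

text \<open>Clearing the inverse in \<open>x = g\<close> acting on the identity turns triviality of
  a class into solvability of a recursion. This form is used for \<open>G\<close>, the Gray towers
  and the kernel tower alike.\<close>

lemma lim1_class_eq_base_iff:
  assumes x: "\<And>n. x n \<in> carrier (G n)"
  shows "lim1_class G p x = lim1_base G p \<longleftrightarrow>
    (\<exists>g. \<forall>n. g n \<in> carrier (G n) \<and> x n \<otimes>\<^bsub>G n\<^esub> p n (g (Suc n)) = g n)"
proof -
  let ?P = "product_group UNIV G"
  interpret P: Group.group ?P by (rule group_prod)
  have xc: "x \<in> carrier ?P" using x carrier_prod by blast
  have eq: "x n = lim1_action G p g \<one>\<^bsub>?P\<^esub> n \<longleftrightarrow> x n \<otimes>\<^bsub>G n\<^esub> p n (g (Suc n)) = g n"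
    if g: "\<And>n. g n \<in> carrier (G n)" for g n
  proof -
    interpret Group.group "G n" by (rule group)
    have "lim1_action G p g \<one>\<^bsub>?P\<^esub> n = g n \<otimes>\<^bsub>G n\<^esub> inv\<^bsub>G n\<^esub> (p n (g (Suc n)))"
      unfolding lim1_action_def using P.one_closed g
      by (simp del: carrier_product_group)
    then show ?thesis
      using x[of n] g map_closed[OF g] by (metis inv_solve_right)
  qed
  have "lim1_class G p x = lim1_base G p \<longleftrightarrow> x \<in> lim1_base G p"
    unfolding lim1_base_def using lim1_class_self[OF xc] lim1_class_eq(2)[OF P.one_closed] by metis
  also have "\<dots> \<longleftrightarrow> (\<exists>g. (\<forall>n. g n \<in> carrier (G n)) \<and> x = lim1_action G p g \<one>\<^bsub>?P\<^esub>)"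
    unfolding lim1_base_def lim1_class_def orbit_def using carrier_prod by blast
  also have "\<dots> \<longleftrightarrow> (\<exists>g. \<forall>n. g n \<in> carrier (G n) \<and> x n \<otimes>\<^bsub>G n\<^esub> p n (g (Suc n)) = g n)"
    unfolding fun_eq_iff using eq by meson
  finally show ?thesis .
qed

section \<open>Composite structure maps and cosets of partial solutions\<close>

lemma tower_trans_refl: "tower_trans p n n = id"
  by (cases n) simp_all

lemma tower_trans_trans:
  "k \<le> m \<Longrightarrow> m \<le> n \<Longrightarrow> tower_trans p k n = tower_trans p k m \<circ> tower_trans p m n"
proof (induction n)
  case (Suc n)
  then show ?case
    by (cases "m \<le> n") (auto simp: tower_trans_refl comp_assoc le_Suc_eq)
qed simp

lemma tower_trans_group_hom: "k \<le> n \<Longrightarrow> group_hom (G n) (G k) (tower_trans p k n)"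
  using tower_trans_hom group by (simp add: group_hom_def group_hom_axioms_def)

text \<open>The elements of \<open>G n\<close> that start a solution of \<open>g i = x i \<otimes> p i (g (i + 1))\<close> for
  \<open>n \<le> i < N\<close> form a coset of the image of \<open>G N\<close>, represented by this product.\<close>

primrec tower_prod :: "(nat \<Rightarrow> 'a) \<Rightarrow> nat \<Rightarrow> nat \<Rightarrow> 'a" where
  "tower_prod x n 0 = \<one>\<^bsub>G n\<^esub>"
| "tower_prod x n (Suc N) =
    (if n \<le> N then tower_prod x n N \<otimes>\<^bsub>G n\<^esub> tower_trans p n N (x N) else \<one>\<^bsub>G n\<^esub>)"

definition tower_coset :: "(nat \<Rightarrow> 'a) \<Rightarrow> nat \<Rightarrow> nat \<Rightarrow> 'a set" where
  "tower_coset x n N =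
    (\<lambda>z. tower_prod x n N \<otimes>\<^bsub>G n\<^esub> tower_trans p n N z) ` carrier (G N)"

lemma tower_trans_closed: "k \<le> n \<Longrightarrow> z \<in> carrier (G n) \<Longrightarrow> tower_trans p k n z \<in> carrier (G k)"
  using tower_trans_hom[of k n] by (auto simp: hom_def)

lemma tower_prod_refl: "tower_prod x n n = \<one>\<^bsub>G n\<^esub>"
  by (cases n) simp_all

context
  fixes x assumes x: "\<And>n. x n \<in> carrier (G n)"
begin

lemma tower_prod_closed: "tower_prod x n N \<in> carrier (G n)"
proof -
  interpret Group.group "G n" by (rule group)
  show ?thesis by (induction N) (simp_all add: tower_trans_closed x)
qed

lemma tower_coset_refl: "tower_coset x n n = carrier (G n)"
proof -
  interpret Group.group "G n" by (rule group)
  show ?thesis by (auto simp: tower_coset_def tower_trans_refl tower_prod_refl)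
qed

text \<open>The definition appends factors at the far end \<open>N\<close>; peeling off the first
  one instead relates level \<open>n\<close> to level \<open>n + 1\<close>.\<close>

lemma tower_prod_unfold:
  "n < N \<Longrightarrow> tower_prod x n N = x n \<otimes>\<^bsub>G n\<^esub> p n (tower_prod x (Suc n) N)"
proof (induction N)
  case (Suc N)
  interpret Group.group "G n" by (rule group)
  show ?case
  proof (cases "n < N")
    case True
    then have "tower_trans p n N (x N) = p n (tower_trans p (Suc n) N (x N))"
      by (simp add: tower_trans_Suc)
    then show ?thesis
      using True Suc.IH tower_trans_closed[of "Suc n" N "x N"] x map_closed tower_prod_closed
      by (simp add: map_mult m_assoc)
  next
    case False
    then have "N = n" using Suc.prems by simp
    then show ?thesis by (simp add: tower_prod_refl tower_trans_refl x map_one)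
  qed
qed simp

lemma tower_coset_lift:
  assumes "n < N" "y \<in> tower_coset x n N"
  shows "\<exists>y'\<in>tower_coset x (Suc n) N. y = x n \<otimes>\<^bsub>G n\<^esub> p n y'"
proof -
  interpret Group.group "G n" by (rule group)
  obtain z where z: "z \<in> carrier (G N)" "y = tower_prod x n N \<otimes>\<^bsub>G n\<^esub> tower_trans p n N z"
    using assms(2) unfolding tower_coset_def by blast
  let ?y = "tower_prod x (Suc n) N \<otimes>\<^bsub>G (Suc n)\<^esub> tower_trans p (Suc n) N z"
  have "y = x n \<otimes>\<^bsub>G n\<^esub> p n ?y"
    using assms(1) z x tower_prod_closed map_closed tower_trans_closed[of "Suc n" N z]
    by (simp add: tower_prod_unfold tower_trans_Suc map_mult m_assoc)
  then show ?thesis unfolding tower_coset_def using z(1) by blast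
qed

text \<open>The additional factor \<open>x N\<close> is absorbed into the free element of
  \<open>G N\<close>.\<close>

lemma tower_coset_Suc_subset:
  assumes "n \<le> N" shows "tower_coset x n (Suc N) \<subseteq> tower_coset x n N"
proof
  interpret Group.group "G n" by (rule group)
  interpret N: Group.group "G N" by (rule group)
  interpret t: group_hom "G N" "G n" "tower_trans p n N" by (rule tower_trans_group_hom[OF assms])
  fix y assume "y \<in> tower_coset x n (Suc N)"
  then obtain z where z: "z \<in> carrier (G (Suc N))"
    "y = tower_prod x n (Suc N) \<otimes>\<^bsub>G n\<^esub> tower_trans p n (Suc N) z"
    unfolding tower_coset_def by blast
  then have "y = tower_prod x n N \<otimes>\<^bsub>G n\<^esub> tower_trans p n N (x N \<otimes>\<^bsub>G N\<^esub> p N z)"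
    using assms x tower_prod_closed map_closed by (simp add: m_assoc)
  then show "y \<in> tower_coset x n N"
    unfolding tower_coset_def using x map_closed[OF z(1)] by blast
qed

lemma tower_coset_subset_Suc:
  assumes "n \<le> N"
    and im: "tower_trans p n N ` carrier (G N) \<subseteq> tower_trans p n (Suc N) ` carrier (G (Suc N))"
  shows "tower_coset x n N \<subseteq> tower_coset x n (Suc N)"
proof
  interpret Group.group "G n" by (rule group)
  interpret N: Group.group "G N" by (rule group)
  interpret t: group_hom "G N" "G n" "tower_trans p n N"
    by (rule tower_trans_group_hom[OF assms(1)])
  fix y assume "y \<in> tower_coset x n N"
  then obtain z where z: "z \<in> carrier (G N)"
    "y = tower_prod x n N \<otimes>\<^bsub>G n\<^esub> tower_trans p n N z"
    unfolding tower_coset_def by blast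
  \<comment> \<open>To absorb \<open>x N\<close> in the other direction, the free element must
    become \<open>inv x N\<close> times \<open>z\<close>; stability of the images replaces it by one
    coming from \<open>G (Suc N)\<close>.\<close>
  have "tower_trans p n N (inv\<^bsub>G N\<^esub> x N \<otimes>\<^bsub>G N\<^esub> z) \<in> tower_trans p n N ` carrier (G N)"
    using x z by blast
  then obtain w where w: "w \<in> carrier (G (Suc N))"
    "tower_trans p n N (inv\<^bsub>G N\<^esub> x N \<otimes>\<^bsub>G N\<^esub> z) = tower_trans p n (Suc N) w"
    using im by blast
  have "tower_trans p n N (x N) \<otimes>\<^bsub>G n\<^esub> tower_trans p n (Suc N) w = tower_trans p n N z"
    unfolding w(2)[symmetric] using x z(1) by (simp add: m_assoc[symmetric])
  then have "y = tower_prod x n (Suc N) \<otimes>\<^bsub>G n\<^esub> tower_trans p n (Suc N) w"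
    using assms(1) z x w(1) tower_prod_closed tower_trans_closed[of n "Suc N" w]
    by (simp add: m_assoc del: tower_trans.simps)
  then show "y \<in> tower_coset x n (Suc N)"
    unfolding tower_coset_def using w(1) by blast
qed

end

section \<open>Vanishing of the first derived limit for Mittag-Leffler towers\<close>

definition mittag_leffler :: bool where
  "mittag_leffler \<longleftrightarrow> (\<forall>n. \<exists>N\<ge>n. \<forall>M\<ge>N.
    tower_trans p n M ` carrier (G M) = tower_trans p n N ` carrier (G N))"

text \<open>Stable images make the cosets of starting values at each level stable. Their
  intersection is thus nonempty and its elements lift level by level, which yields a full
  solution.\<close>

lemma mittag_leffler_lim1_class:
  assumes ml: mittag_leffler and x: "\<And>n. x n \<in> carrier (G n)"
  shows "lim1_class G p x = lim1_base G p"
proof -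
  have stable: "\<exists>N\<ge>n. \<forall>M\<ge>n. tower_coset x n N \<subseteq> tower_coset x n M" for n
  proof -
    obtain N where N: "N \<ge> n" "\<And>M. M \<ge> N \<Longrightarrow>
        tower_trans p n M ` carrier (G M) = tower_trans p n N ` carrier (G N)"
      using ml unfolding mittag_leffler_def by blast
    have up: "tower_coset x n N \<subseteq> tower_coset x n M" if "N \<le> M" for M
      using that
    proof (induction M rule: dec_induct)
      case (step M)
      have "tower_coset x n M \<subseteq> tower_coset x n (Suc M)"
      proof (rule tower_coset_subset_Suc[OF x])
        show "n \<le> M" using step.hyps N(1) by simp
        show "tower_trans p n M ` carrier (G M) \<subseteq> tower_trans p n (Suc M) ` carrier (G (Suc M))"
          using N(2)[OF step.hyps(1)] N(2)[OF le_SucI[OF step.hyps(1)]] by blast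
      qed
      then show ?case using step.IH by blast
    qed simp
    have down: "n \<le> M \<longrightarrow> tower_coset x n N \<subseteq> tower_coset x n M" if "M \<le> N" for M
      using that
    proof (induction M rule: inc_induct)
      case (step M)
      then show ?case using tower_coset_Suc_subset[OF x, of n M] by auto
    qed simp
    have "tower_coset x n N \<subseteq> tower_coset x n M" if "n \<le> M" for M
      using up[of M] down[of M] that by (cases "N \<le> M") auto
    then show ?thesis using N(1) by blast
  qed
  have "\<exists>g. \<forall>n. (\<forall>M\<ge>n. g n \<in> tower_coset x n M) \<and> g n = x n \<otimes>\<^bsub>G n\<^esub> p n (g (Suc n))"
  proof (rule dependent_nat_choice)
    obtain N where "\<forall>M\<ge>0. tower_coset x 0 N \<subseteq> tower_coset x 0 M" using stable by blast
    moreover have "tower_coset x 0 N \<noteq> {}" using x[of N] unfolding tower_coset_def by auto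
    ultimately show "\<exists>y. \<forall>M\<ge>0. y \<in> tower_coset x 0 M" by blast
  next
    \<comment> \<open>The lift is taken in the coset for an \<open>N\<close> that is already stable
      at level \<open>Suc n\<close>, so it meets the conditions for all \<open>M\<close> at
      once.\<close>
    fix y n assume y: "\<forall>M\<ge>n. y \<in> tower_coset x n M"
    obtain N where N: "N \<ge> Suc n" "\<forall>M\<ge>Suc n. tower_coset x (Suc n) N \<subseteq> tower_coset x (Suc n) M"
      using stable by blast
    have "y \<in> tower_coset x n N" using y N(1) by simp
    then obtain y' where "y' \<in> tower_coset x (Suc n) N" "y = x n \<otimes>\<^bsub>G n\<^esub> p n y'"
      using tower_coset_lift[OF x, of n N y] N(1) by auto
    then show "\<exists>y'. (\<forall>M\<ge>Suc n. y' \<in> tower_coset x (Suc n) M) \<and> y = x n \<otimes>\<^bsub>G n\<^esub> p n y'"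
      using N(2) by blast
  qed
  then obtain g where g: "\<And>n. g n \<in> tower_coset x n n" "\<And>n. g n = x n \<otimes>\<^bsub>G n\<^esub> p n (g (Suc n))"
    by blast
  then show ?thesis
    using lim1_class_eq_base_iff[OF x] tower_coset_refl[OF x] by metis
qed

section \<open>The kernel tower of the Gray filtration\<close>

definition gray_kernel :: "nat \<Rightarrow> nat \<Rightarrow> 'a set" where
  "gray_kernel k n = kernel (G n) (gray_group G p k n) (gray_surj p k n)"

lemma gray_surj_group_hom: "group_hom (G n) (gray_group G p k n) (gray_surj p k n)"
  using gray_surj_hom group group_gray by (simp add: group_hom_def group_hom_axioms_def)

lemma gray_kernel_subgroup: "subgroup (gray_kernel k n) (G n)"
  unfolding gray_kernel_def by (rule group_hom.subgroup_kernel[OF gray_surj_group_hom])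

lemma gray_kernel_closed: "z \<in> gray_kernel k n \<Longrightarrow> z \<in> carrier (G n)"
  by (simp add: gray_kernel_def kernel_def)

lemma gray_kernel_map:
  assumes "z \<in> gray_kernel k (Suc n)" shows "p n z \<in> gray_kernel k n"
proof -
  interpret K: group_tower "gray_group G p k" "gray_map p k" by (rule gray_tower)
  show ?thesis
    using assms K.map_one map_closed unfolding gray_kernel_def kernel_def
    by (simp add: gray_surj_commutes)
qed

lemma gray_kernel_tower: "group_tower (\<lambda>n. (G n)\<lparr>carrier := gray_kernel k n\<rparr>) p"
proof (rule group_tower.intro)
  fix n
  show "Group.group ((G n)\<lparr>carrier := gray_kernel k n\<rparr>)"
    by (rule group.subgroup_imp_group[OF group gray_kernel_subgroup])
  show "p n \<in> hom ((G (Suc n))\<lparr>carrier := gray_kernel k (Suc n)\<rparr>)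
      ((G n)\<lparr>carrier := gray_kernel k n\<rparr>)"
    by (rule homI) (simp_all add: gray_kernel_map gray_kernel_closed map_mult)
next
  show "trivial_group ((G 0)\<lparr>carrier := gray_kernel k 0\<rparr>)"
    using trivial_bottom group.subgroup_imp_group[OF group gray_kernel_subgroup]
      subgroup.one_closed[OF gray_kernel_subgroup[of k 0]] subgroup.subset[OF gray_kernel_subgroup[of k 0]]
    unfolding trivial_group_def by auto
qed

lemma gray_filtration_class_iff:
  assumes x: "\<And>n. x n \<in> carrier (G n)"
  shows "lim1_class G p x \<in> gray_filtration G p k \<longleftrightarrow>
    lim1_class (gray_group G p k) (gray_map p k) (\<lambda>n. gray_surj p k n (x n))
      = lim1_base (gray_group G p k) (gray_map p k)"
proof -
  have xc: "x \<in> carrier (product_group UNIV G)" using x carrier_prod by blast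
  then have "lim1_class G p x \<in> lim1 G p"
    unfolding lim1_def lim1_class_def orbits_def by blast
  then show ?thesis
    unfolding gray_filtration_def using gray_proj_class[OF xc, of k] by simp
qed

lemma gray_kernel_class:
  assumes "\<And>n. x n \<in> gray_kernel k n"
  shows "lim1_class G p x \<in> gray_filtration G p k"
proof -
  have "(\<lambda>n. gray_surj p k n (x n)) = \<one>\<^bsub>product_group UNIV (gray_group G p k)\<^esub>"
    using assms by (simp add: gray_kernel_def kernel_def restrict_UNIV)
  then show ?thesis
    using gray_filtration_class_iff[of x k] gray_kernel_closed[OF assms]
    unfolding lim1_base_def by simp
qed

text \<open>A trivialising sequence \<open>h\<close> in the Gray tower lifts levelwise along the
  surjections to \<open>g\<close>. Acting on \<open>y\<close> by the inverse of \<open>g\<close>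
  keeps the class and makes the image in the Gray tower the identity.\<close>

lemma gray_filtration_representative:
  assumes "c \<in> gray_filtration G p k"
  obtains x where "\<And>n. x n \<in> gray_kernel k n" "c = lim1_class G p x"
proof -
  let ?K = "gray_group G p k" and ?P = "product_group UNIV G"
  interpret K: group_tower ?K "gray_map p k" by (rule gray_tower)
  interpret P: Group.group ?P by (rule group_prod)
  obtain y where yc: "y \<in> carrier ?P" and c: "c = lim1_class G p y"
    using assms unfolding gray_filtration_def lim1_def lim1_class_def orbits_def by blast
  have y: "y n \<in> carrier (G n)" for n using yc carrier_prod by blast
  have sy: "gray_surj p k n (y n) \<in> carrier (?K n)" for n
    using y gray_surj_onto by blast
  obtain h where h: "\<And>n. h n \<in> carrier (?K n)"
    "\<And>n. gray_surj p k n (y n) \<otimes>\<^bsub>?K n\<^esub> gray_map p k n (h (Suc n)) = h n"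
    using assms c gray_filtration_class_iff[OF y, of k] K.lim1_class_eq_base_iff[OF sy] by blast
  have "\<exists>g. g \<in> carrier (G n) \<and> gray_surj p k n g = h n" for n
    using h(1) gray_surj_onto by (metis imageE)
  then obtain g where g: "\<And>n. g n \<in> carrier (G n)" "\<And>n. gray_surj p k n (g n) = h n" by metis
  define u where "u n = inv\<^bsub>G n\<^esub> g n" for n
  have u: "u n \<in> carrier (G n)" for n
    unfolding u_def by (rule group.inv_closed[OF group g(1)])
  then have uc: "u \<in> carrier ?P" using carrier_prod by blast
  let ?x = "lim1_action G p u y"
  have "?x n \<in> gray_kernel k n" for n
  proof -
    interpret Group.group "G n" by (rule group)
    interpret s: group_hom "G n" "?K n" "gray_surj p k n" by (rule gray_surj_group_hom)
    have hn: "gray_map p k n (h (Suc n)) = gray_surj p k n (p n (g (Suc n)))"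
      using g by (simp add: gray_surj_commutes)
    have pg: "p n (g (Suc n)) \<in> carrier (G n)" using g map_closed by blast
    have pinv: "p n (inv\<^bsub>G (Suc n)\<^esub> g (Suc n)) = inv\<^bsub>G n\<^esub> p n (g (Suc n))"
      by (rule group_hom.hom_inv) (use g map_hom group in \<open>auto simp: group_hom_def group_hom_axioms_def\<close>)
    have "?x n = inv\<^bsub>G n\<^esub> g n \<otimes>\<^bsub>G n\<^esub> (y n \<otimes>\<^bsub>G n\<^esub> p n (g (Suc n)))"
      using yc y g pg by (simp add: lim1_action_def u_def pinv m_assoc del: carrier_product_group)
    moreover have "gray_surj p k n (y n \<otimes>\<^bsub>G n\<^esub> p n (g (Suc n))) = gray_surj p k n (g n)"
      using h(2)[of n] y pg g by (simp add: hn)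
    ultimately show ?thesis
      using y g pg s.hom_closed[OF g(1)] unfolding gray_kernel_def kernel_def by simp
  qed
  moreover have "?x \<in> lim1_class G p y"
    using uc unfolding lim1_class_def orbit_def by blast
  ultimately show thesis using that[of ?x] lim1_class_eq(2)[OF yc] c by metis
qed

section \<open>Stable images in the kernel tower\<close>

lemma gray_kernel_iff:
  assumes "k \<le> n"
  shows "z \<in> gray_kernel k n \<longleftrightarrow> z \<in> carrier (G n) \<and> tower_trans p k n z = \<one>\<^bsub>G k\<^esub>"
  using assms by (simp add: gray_kernel_def kernel_def gray_surj_def gray_group_def)

text \<open>The map to \<open>G k\<close> factors through \<open>G m\<close>, so an element of
  \<open>G n\<close> lies in the kernel exactly when its image in \<open>G m\<close> does.\<close>

lemma tower_trans_gray_kernel: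
  assumes "k \<le> m" "m \<le> n"
  shows "tower_trans p m n ` gray_kernel k n = tower_trans p m n ` carrier (G n) \<inter> gray_kernel k m"
  using assms tower_trans_closed[OF assms(2)] tower_trans_trans[OF assms]
  by (auto simp: gray_kernel_iff)

text \<open>Below \<open>k\<close> the kernels are trivial. From \<open>k\<close> on, the diagonal
  argument applies to the images in \<open>G m\<close>, and \<open>filt\<close> supplies its
  solvability hypothesis.\<close>

lemma gray_kernel_mittag_leffler:
  assumes count: "\<And>n. countable (carrier (G n))"
    and filt: "\<And>m. k \<le> m \<Longrightarrow> gray_filtration G p k \<subseteq> gray_filtration G p m"
  shows "group_tower.mittag_leffler (\<lambda>n. (G n)\<lparr>carrier := gray_kernel k n\<rparr>) p"
  unfolding group_tower.mittag_leffler_def[OF gray_kernel_tower]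
proof
  fix m
  interpret Group.group "G m" by (rule group)
  define B where "B j = tower_trans p m (m + j) ` carrier (G (m + j))" for j
  show "\<exists>N\<ge>m. \<forall>M\<ge>N. tower_trans p m M ` carrier ((G M)\<lparr>carrier := gray_kernel k M\<rparr>)
      = tower_trans p m N ` carrier ((G N)\<lparr>carrier := gray_kernel k N\<rparr>)"
  proof (cases "k \<le> m")
    case False
    have "tower_trans p m M ` gray_kernel k M = {\<one>\<^bsub>G m\<^esub>}" if "m \<le> M" for M
    proof -
      interpret t: group_hom "(G M)\<lparr>carrier := gray_kernel k M\<rparr>" "(G m)\<lparr>carrier := gray_kernel k m\<rparr>"
        "tower_trans p m M"
        using group_tower.tower_trans_group_hom[OF gray_kernel_tower that] .
      have "gray_kernel k m = {\<one>\<^bsub>G m\<^esub>}"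
        using False by (auto simp: gray_kernel_def kernel_def gray_surj_def gray_group_def)
      then show ?thesis
        using t.hom_closed subgroup.one_closed[OF gray_kernel_subgroup[of k M]] by force
    qed
    then show ?thesis by (intro exI[of _ m]) simp
  next
    case True
    have "\<exists>J. \<forall>j\<ge>J. B j \<inter> gray_kernel k m = B J \<inter> gray_kernel k m"
    proof (rule decreasing_subgroups_stabilize)
      fix j
      show "subgroup (B j) (G m)"
        unfolding B_def by (rule group_hom.img_is_subgroup[OF tower_trans_group_hom]) simp
      show "B (Suc j) \<subseteq> B j"
        using map_closed by (auto simp: B_def)
    next
      show "countable (B 0)" unfolding B_def using count by blast
      show "subgroup (gray_kernel k m) (G m)" by (rule gray_kernel_subgroup)
    next
      fix x assume x: "\<And>j. x j \<in> B j \<inter> gray_kernel k m"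
      have "\<exists>z. z \<in> gray_kernel k (m + j) \<and> tower_trans p m (m + j) z = x j" for j
        using x[of j] tower_trans_gray_kernel[OF True, of "m + j"] unfolding B_def
        by (metis imageE le_add1)
      then obtain z where z: "\<And>j. z j \<in> gray_kernel k (m + j)"
        "\<And>j. tower_trans p m (m + j) (z j) = x j" by metis
      \<comment> \<open>Shifting by \<open>m\<close> and padding with identities makes the lifts a
        sequence over all levels that still lies in the kernels.\<close>
      define w where "w n = (if m \<le> n then z (n - m) else \<one>\<^bsub>G n\<^esub>)" for n
      have wk: "w n \<in> gray_kernel k n" for n
        using z(1)[of "n - m"] subgroup.one_closed[OF gray_kernel_subgroup]
        by (cases "m \<le> n") (simp_all add: w_def)
      let ?H = "gray_group G p m"
      interpret H: group_tower ?H "gray_map p m" by (rule gray_tower)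
      have wc: "w n \<in> carrier (G n)" for n using wk gray_kernel_closed by blast
      have sw: "gray_surj p m n (w n) \<in> carrier (?H n)" for n
        using wc gray_surj_onto by blast
      have "lim1_class G p w \<in> gray_filtration G p m"
        using gray_kernel_class[OF wk] filt[OF True] by blast
      then obtain g where g: "\<And>n. g n \<in> carrier (?H n)"
        "\<And>n. gray_surj p m n (w n) \<otimes>\<^bsub>?H n\<^esub> gray_map p m n (g (Suc n)) = g n"
        using gray_filtration_class_iff[OF wc, of m] H.lim1_class_eq_base_iff[OF sw] by blast
      \<comment> \<open>From level \<open>m\<close> on, the Gray group is an image inside
        \<open>G m\<close> and its structure map is the identity, so the recursion for
        \<open>g\<close> becomes the one required of \<open>b\<close>.\<close>
      have "g (m + j) \<in> B j \<and> x j \<otimes>\<^bsub>G m\<^esub> g (m + Suc j) = g (m + j)" for j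
      proof
        show "g (m + j) \<in> B j"
          using g(1)[of "m + j"] by (simp add: B_def gray_group_def)
        have "gray_surj p m (m + j) (w (m + j)) = x j"
          using z(2)[of j] by (simp add: gray_surj_def w_def)
        then show "x j \<otimes>\<^bsub>G m\<^esub> g (m + Suc j) = g (m + j)"
          using g(2)[of "m + j"] by (simp add: gray_group_def gray_map_def)
      qed
      then show "\<exists>b. \<forall>j. b j \<in> B j \<and> x j \<otimes>\<^bsub>G m\<^esub> b (Suc j) = b j"
        by (intro exI[of _ "\<lambda>j. g (m + j)"]) blast
    qed
    then obtain J where J: "\<And>j. j \<ge> J \<Longrightarrow> B j \<inter> gray_kernel k m = B J \<inter> gray_kernel k m" by blast
    have eq: "tower_trans p m M ` gray_kernel k M = B (M - m) \<inter> gray_kernel k m" if "m \<le> M" for M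
      using tower_trans_gray_kernel[OF True that] that by (simp add: B_def)
    show ?thesis
    proof (intro exI[of _ "m + J"] conjI allI impI)
      fix M assume "m + J \<le> M"
      then show "tower_trans p m M ` carrier ((G M)\<lparr>carrier := gray_kernel k M\<rparr>)
          = tower_trans p m (m + J) ` carrier ((G (m + J))\<lparr>carrier := gray_kernel k (m + J)\<rparr>)"
        using J[of "M - m"] by (simp add: eq)
    qed simp
  qed
qed

end

theorem theorem2p15:
  fixes G :: "nat \<Rightarrow> ('a, 'b) monoid_scheme" and p :: "nat \<Rightarrow> 'a \<Rightarrow> 'a" and k :: nat
  assumes "group_tower G p"
    and "\<And>n. countable (carrier (G n))"
    and "gray_filtration_inf G p = gray_filtration G p k"
  shows "gray_filtration G p k = {lim1_base G p}"
proof -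
  interpret group_tower G p by (rule assms(1))
  let ?K = "\<lambda>n. (G n)\<lparr>carrier := gray_kernel k n\<rparr>"
  interpret K: group_tower ?K p by (rule gray_kernel_tower)
  \<comment> \<open>The assumed equality puts the \<open>k\<close>-th filtration stage inside every
    other stage, which gives the inclusions needed here.\<close>
  have ml: K.mittag_leffler
    using assms(3) unfolding gray_filtration_inf_def
    by (intro gray_kernel_mittag_leffler assms(2)) blast
  have "c = lim1_base G p" if c_mem: "c \<in> gray_filtration G p k" for c
  proof -
    obtain x where x: "\<And>n. x n \<in> gray_kernel k n" and c: "c = lim1_class G p x"
      using gray_filtration_representative[OF c_mem] by blast
    have "lim1_class ?K p x = lim1_base ?K p"
      using K.mittag_leffler_lim1_class[OF ml, of x] x by simp
    \<comment> \<open>A solution in the kernel tower is also one in \<open>G\<close>, because the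
      operations are restrictions.\<close>
    then obtain g where "\<And>n. g n \<in> gray_kernel k n" "\<And>n. x n \<otimes>\<^bsub>G n\<^esub> p n (g (Suc n)) = g n"
      using K.lim1_class_eq_base_iff[of x] x by auto
    then show ?thesis
      using lim1_class_eq_base_iff[of x] x gray_kernel_closed c by blast
  qed
  moreover have "lim1_base G p \<in> gray_filtration G p k"
    unfolding lim1_base_def
    by (rule gray_kernel_class)
      (simp add: restrict_UNIV subgroup.one_closed[OF gray_kernel_subgroup])
  ultimately show ?thesis by blast
qed

end
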